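(* Let $\alpha_1\ge4$ be the constant of the Kulikov–Dam Larsen theorem (recalled in the context). Then the following are equivalent. (i) There exist constants $\alpha\ge4$, $\delta_0\in(0,\tfrac12)$, $\kappa>0$, $C<\infty$, $c_0<\infty$ such that $D(\delta,c)\ge\kappa L\ln\bigl(\frac{\alpha c}{L}\bigr)-C$ for every $c\ge c_0$ and every $\delta$ with $\alpha^{-c}<\delta\le\delta_0$. (ii) There exist $\delta_0\in(0,\tfrac12)$, $\kappa>0$, $C<\infty$, $c_0<\infty$ such that $D(\delta,c)\ge\kappa L\ln\bigl(\frac{\alpha_1c}{L}\bigr)-C$ for every $c\ge c_0$ and every $\delta$ with $c^{-\alpha_1}\le\delta\le\delta_0$.
   Context: For $c>0$, $S_c$ is the positive trace-class integral operator on $L^2(0,c)$ with kernel $\frac{\sin(\pi(x-y))}{\pi(x-y)}$ (equal to $1$ for $x=y$); its eigenvalues are simple, $1>\lambda_0(c)>\lambda_1(c)>\cdots>0$. For $0<\delta<\tfrac12$, $L=\ln\frac1\delta$, $\Lambda^+_\delta(c)=\#\{n:\tfrac12<\lambda_n(c)\le1-\delta\}$ and $D(\delta,c)=\Lambda^-_\delta(c)=\#\{n:\delta<\lambda_n(c)\le\tfrac12\}$. $\ln$ is the natural logarithm. Kulikov–Dam Larsen theorem (known result, dimension one; may be used): there exists a constant $\alpha_1\ge4$ such that, for every $c\ge2$, with $L=\ln\frac1\varepsilon$ and $R=\ln\frac{\alpha_1c}{L}$, and with absolute implied constants: (a) uniformly for $\alpha_1^{-c}<\varepsilon<\tfrac12$,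 $\Lambda^\pm_\varepsilon(c)\lesssim LR$; (b) if moreover $\varepsilon<c^{-\alpha_1}$, then also $\Lambda^\pm_\varepsilon(c)\gtrsim LR$; (c) if $\varepsilon\le\alpha_1^{-c}$ there are no eigenvalues above $1-\varepsilon$ and $\Lambda^-_\varepsilon(c)\asymp L/\ln(L/c)$. (Open/closed endpoint conventions may change the counts by at most $2$.) Such an $\alpha_1$ is fixed. *)

theory Defs
  imports "HOL-Analysis.Analysis"
begin

definition sinc_kernel :: "real \<Rightarrow> real \<Rightarrow> real" where
  "sinc_kernel x y = (if x = y then 1 else sin (pi * (x - y)) / (pi * (x - y)))"

text \<open>Elements of $L^2(0,c)$ are represented by functions, with equality almost everywhere on
  $(0,c)$ made explicit where it is needed.\<close>

definition L2_interval :: "real \<Rightarrow> (real \<Rightarrow> complex) set" where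
  "L2_interval c = {f. f \<in> borel_measurable (lebesgue_on {0<..<c}) \<and>
     integrable (lebesgue_on {0<..<c}) (\<lambda>x. (norm (f x))\<^sup>2)}"

definition sinc_operator :: "real \<Rightarrow> (real \<Rightarrow> complex) \<Rightarrow> real \<Rightarrow> complex" where
  "sinc_operator c f x =
     integral\<^sup>L (lebesgue_on {0<..<c}) (\<lambda>y. complex_of_real (sinc_kernel x y) * f y)"

definition is_eigenvalue :: "real \<Rightarrow> real \<Rightarrow> bool" where
  "is_eigenvalue c \<mu> \<longleftrightarrow> (\<exists>f \<in> L2_interval c.
     \<not> (AE x in lebesgue_on {0<..<c}. f x = 0) \<and>
     (AE x in lebesgue_on {0<..<c}. sinc_operator c f x = complex_of_real \<mu> * f x))"

text \<open>For $c > 0$ the operator is positive, compact and injective with infinite-dimensional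
  range and simple spectrum, so its eigenvalues form one strictly decreasing sequence, each
  occurring once; this sequence is the value of \<open>eigenvalue_seq c\<close>.\<close>

definition is_eigenvalue_enumeration :: "real \<Rightarrow> (nat \<Rightarrow> real) \<Rightarrow> bool" where
  "is_eigenvalue_enumeration c l \<longleftrightarrow>
     (\<forall>m n. m < n \<longrightarrow> l n < l m) \<and> range l = {\<mu>. is_eigenvalue c \<mu>}"

definition eigenvalue_seq :: "real \<Rightarrow> nat \<Rightarrow> real" where
  "eigenvalue_seq c = (THE l. is_eigenvalue_enumeration c l)"

lemma is_eigenvalue_enumeration_unique:
  assumes "is_eigenvalue_enumeration c l" "is_eigenvalue_enumeration c m"
  shows "l = m"
proof
  have le: "p n \<le> q n"
    if p: "is_eigenvalue_enumeration c p" and q: "is_eigenvalue_enumeration c q"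
      and IH: "\<And>k. k < n \<Longrightarrow> p k = q k" for p q n
  proof -
    have "p n \<in> range q"
      using p q unfolding is_eigenvalue_enumeration_def by blast
    then obtain k where k: "p n = q k" by blast
    have "\<not> k < n"
      using IH[of k] k p unfolding is_eigenvalue_enumeration_def by (metis less_irrefl)
    then have "n = k \<or> n < k" by auto
    then show ?thesis
      using k q unfolding is_eigenvalue_enumeration_def by fastforce
  qed
  show "l n = m n" for n
  proof (induction n rule: less_induct)
    case (less n)
    then show ?case
      using le[of l m n] le[of m l n] assms by (simp add: order_antisym)
  qed
qed

lemma eigenvalue_seq_eq:
  "is_eigenvalue_enumeration c l \<Longrightarrow> eigenvalue_seq c = l"
  unfolding eigenvalue_seq_def using is_eigenvalue_enumeration_unique by blast

definition Lambda_plus :: "real \<Rightarrow> real \<Rightarrow> nat" where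
  "Lambda_plus \<delta> c = card {n. 1/2 < eigenvalue_seq c n \<and> eigenvalue_seq c n \<le> 1 - \<delta>}"

definition Lambda_minus :: "real \<Rightarrow> real \<Rightarrow> nat" where
  "Lambda_minus \<delta> c = card {n. \<delta> < eigenvalue_seq c n \<and> eigenvalue_seq c n \<le> 1/2}"

abbreviation D :: "real \<Rightarrow> real \<Rightarrow> nat" where
  "D \<equiv> Lambda_minus"

text \<open>The assertion of the Kulikov--Dam Larsen theorem for a given constant \<open>\<alpha>\<^sub>1\<close>. The implied
  constants \<open>k\<close>, \<open>K\<close> are chosen before \<open>c\<close> and \<open>\<epsilon>\<close>.\<close>

definition Kulikov_Dam_Larsen_constant :: "real \<Rightarrow> bool" where
  "Kulikov_Dam_Larsen_constant \<alpha>\<^sub>1 \<longleftrightarrow> 4 \<le> \<alpha>\<^sub>1 \<and>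
     (\<exists>K>0. \<forall>c\<ge>2. \<forall>\<epsilon>. \<alpha>\<^sub>1 powr (- c) < \<epsilon> \<and> \<epsilon> < 1/2 \<longrightarrow>
        (let L = ln (1 / \<epsilon>); R = ln (\<alpha>\<^sub>1 * c / L) in
          real (Lambda_plus \<epsilon> c) \<le> K * (L * R) \<and> real (Lambda_minus \<epsilon> c) \<le> K * (L * R))) \<and>
     (\<exists>k>0. \<forall>c\<ge>2. \<forall>\<epsilon>. \<alpha>\<^sub>1 powr (- c) < \<epsilon> \<and> \<epsilon> < 1/2 \<and> \<epsilon> < c powr (- \<alpha>\<^sub>1) \<longrightarrow>
        (let L = ln (1 / \<epsilon>); R = ln (\<alpha>\<^sub>1 * c / L) in
          k * (L * R) \<le> real (Lambda_plus \<epsilon> c) \<and> k * (L * R) \<le> real (Lambda_minus \<epsilon> c))) \<and>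
     (\<exists>k>0. \<exists>K>0. \<forall>c\<ge>2. \<forall>\<epsilon>. 0 < \<epsilon> \<and> \<epsilon> \<le> \<alpha>\<^sub>1 powr (- c) \<longrightarrow>
        (\<forall>n. eigenvalue_seq c n \<le> 1 - \<epsilon>) \<and>
        (let L = ln (1 / \<epsilon>) in
          k * (L / ln (L / c)) \<le> real (Lambda_minus \<epsilon> c) \<and>
          real (Lambda_minus \<epsilon> c) \<le> K * (L / ln (L / c))))"

end

theory Submission
  imports Defs "HOL-Real_Asymp.Real_Asymp"
begin

text \<open>The two ranges of \<open>\<delta>\<close> differ by \<open>\<alpha>\<^sub>1 powr (- c) < \<delta> < c powr (- \<alpha>\<^sub>1)\<close>, where part (b) of the
  Kulikov--Dam Larsen theorem gives the lower bound. The change of constant is harmless: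
  \<open>c powr (- \<alpha>\<^sub>1) \<le> \<delta>\<close> forces \<open>L = O(ln c)\<close>, so that \<open>c / L\<close> is eventually large and
  \<open>\<alpha>\<^sub>1 c / L \<le> (\<alpha> c / L)\<^sup>2\<close>.\<close>

lemma ln_inverse_less:
  fixes a c \<delta> :: real
  assumes "1 < a" "a powr (- c) < \<delta>"
  shows "ln (1 / \<delta>) < c * ln a"
proof -
  have *: "0 < a powr (- c)" using assms by simp
  then have "0 < \<delta>" using assms(2) by linarith
  then have "ln (a powr (- c)) < ln \<delta>"
    using * assms(2) by (simp only: ln_less_cancel_iff)
  with \<open>0 < \<delta>\<close> assms(1) show ?thesis
    by (simp add: ln_powr ln_div)
qed

lemma ln_inverse_le:
  fixes a c \<delta> :: real
  assumes "0 < c" "c powr (- a) \<le> \<delta>"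
  shows "ln (1 / \<delta>) \<le> a * ln c"
proof -
  have *: "0 < c powr (- a)" using assms by simp
  then have "0 < \<delta>" using assms(2) by linarith
  then have "ln (c powr (- a)) \<le> ln \<delta>"
    using * assms(2) by (simp only: ln_le_cancel_iff)
  with \<open>0 < \<delta>\<close> assms(1) show ?thesis
    by (simp add: ln_powr ln_div)
qed

text \<open>Since \<open>ln a \<le> a - 1 < a\<close>, the bound on \<open>L\<close> gives
  \<open>L \<le> a * c\<close>, so the ratio is at least 1. The sign is what later allows the
  coefficient of \<open>L * R\<close> to be lowered.\<close>

lemma ln_ratio_nonneg:
  fixes a c L :: real
  assumes "1 < a" "0 < L" "L < c * ln a"
  shows "0 \<le> ln (a * c / L)"
proof -
  have "0 < ln a" using assms by simp
  then have "0 < c"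
    using assms by (metis less_trans zero_less_mult_pos2)
  have "L \<le> c * a"
    using assms(3) ln_le_minus_one[of a] assms(1) \<open>0 < c\<close>
    by (smt (verit) mult_left_mono)
  then show ?thesis
    using assms(2) by (intro ln_ge_zero) (simp add: field_simps)
qed

text \<open>Once \<open>c / L\<close> is at least \<open>b\<close>, one factor \<open>c / L\<close>
  can stand in for the constant \<open>b\<close>:
  \<open>b * (c / L) \<le> (c / L)\<^sup>2 \<le> (a * c / L)\<^sup>2\<close>. Hence no relation
  between \<open>a\<close> and \<open>b\<close> is required, and the price of exchanging them is
  only the factor 2.\<close>

lemma ln_ratio_le_double:
  fixes a b c L :: real
  assumes "1 \<le> a" "0 < b" "0 < c" "0 < L" "b * L \<le> c"
  shows "ln (b * c / L) \<le> 2 * ln (a * c / L)"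
proof -
  have "b \<le> c / L"
    using assms by (simp add: field_simps)
  also have "\<dots> \<le> a\<^sup>2 * (c / L)"
    using assms mult_right_mono[of 1 "a\<^sup>2" "c / L"] by (simp add: one_le_power)
  finally have "b * (c / L) \<le> a\<^sup>2 * (c / L) * (c / L)"
    using assms by (intro mult_right_mono) auto
  then have "b * c / L \<le> (a * c / L)\<^sup>2"
    by (simp add: power2_eq_square mult_ac)
  then have "ln (b * c / L) \<le> ln ((a * c / L)\<^sup>2)"
    using assms by (subst ln_le_cancel_iff) auto
  also have "\<dots> = 2 * ln (a * c / L)"
    using assms by (subst ln_realpow) auto
  finally show ?thesis .
qed

theorem proposition1p18:
  fixes \<alpha>\<^sub>1 :: real
  assumes "Kulikov_Dam_Larsen_constant \<alpha>\<^sub>1"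
  shows
    "(\<exists>\<alpha> \<delta>\<^sub>0 \<kappa> C c\<^sub>0 :: real. 4 \<le> \<alpha> \<and> 0 < \<delta>\<^sub>0 \<and> \<delta>\<^sub>0 < 1/2 \<and> 0 < \<kappa> \<and>
        (\<forall>c>0. \<forall>\<delta>. c\<^sub>0 \<le> c \<and> \<alpha> powr (- c) < \<delta> \<and> \<delta> \<le> \<delta>\<^sub>0 \<longrightarrow>
          (let L = ln (1 / \<delta>) in \<kappa> * L * ln (\<alpha> * c / L) - C \<le> real (D \<delta> c))))
     \<longleftrightarrow>
     (\<exists>\<delta>\<^sub>0 \<kappa> C c\<^sub>0 :: real. 0 < \<delta>\<^sub>0 \<and> \<delta>\<^sub>0 < 1/2 \<and> 0 < \<kappa> \<and>
        (\<forall>c>0. \<forall>\<delta>. c\<^sub>0 \<le> c \<and> c powr (- \<alpha>\<^sub>1) \<le> \<delta> \<and> \<delta> \<le> \<delta>\<^sub>0 \<longrightarrow>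
          (let L = ln (1 / \<delta>) in \<kappa> * L * ln (\<alpha>\<^sub>1 * c / L) - C \<le> real (D \<delta> c))))"
proof -
  have \<alpha>1: "4 \<le> \<alpha>\<^sub>1"
    using assms by (simp add: Kulikov_Dam_Larsen_constant_def)
  have "\<exists>k>0. \<forall>c\<ge>2. \<forall>\<epsilon>. \<alpha>\<^sub>1 powr (- c) < \<epsilon> \<and> \<epsilon> < 1/2 \<and> \<epsilon> < c powr (- \<alpha>\<^sub>1) \<longrightarrow>
      (let L = ln (1 / \<epsilon>); R = ln (\<alpha>\<^sub>1 * c / L) in
        k * (L * R) \<le> real (Lambda_plus \<epsilon> c) \<and> k * (L * R) \<le> real (D \<epsilon> c))"
    by (rule assms[unfolded Kulikov_Dam_Larsen_constant_def, THEN conjunct2, THEN conjunct2,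
          THEN conjunct1])
  then obtain k where k: "0 < k"
    and KDL: "\<forall>c\<ge>2. \<forall>\<epsilon>. \<alpha>\<^sub>1 powr (- c) < \<epsilon> \<and> \<epsilon> < 1/2 \<and> \<epsilon> < c powr (- \<alpha>\<^sub>1) \<longrightarrow>
      (let L = ln (1 / \<epsilon>); R = ln (\<alpha>\<^sub>1 * c / L) in
        k * (L * R) \<le> real (Lambda_plus \<epsilon> c) \<and> k * (L * R) \<le> real (D \<epsilon> c))"
    by (elim exE conjE) (rule that)
  show ?thesis (is "?i \<longleftrightarrow> ?ii")
  proof
    assume ?i
    then obtain \<alpha> \<delta>\<^sub>0 \<kappa> C c\<^sub>0 :: real where \<alpha>: "4 \<le> \<alpha>"
      and \<delta>0: "0 < \<delta>\<^sub>0" "\<delta>\<^sub>0 < 1/2" and \<kappa>: "0 < \<kappa>"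
      and bound: "\<forall>c>0. \<forall>\<delta>. c\<^sub>0 \<le> c \<and> \<alpha> powr (- c) < \<delta> \<and> \<delta> \<le> \<delta>\<^sub>0 \<longrightarrow>
        (let L = ln (1 / \<delta>) in \<kappa> * L * ln (\<alpha> * c / L) - C \<le> real (D \<delta> c))"
      by (elim exE conjE) (rule that)
    \<comment> \<open>The square is chosen so that \<open>L \<le> \<alpha>\<^sub>1 * ln c\<close>
      turns into \<open>\<alpha>\<^sub>1 * L \<le> c\<close>. That inequality serves twice: it
      places \<open>\<delta>\<close> in the range of the assumed bound, and it is the hypothesis of
      \<open>ln_ratio_le_double\<close> with \<open>b = \<alpha>\<^sub>1\<close>.\<close>
    have "eventually (\<lambda>c::real. \<alpha>\<^sub>1\<^sup>2 * ln c \<le> c) at_top"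
      by real_asymp
    then obtain c\<^sub>1 where c1: "\<And>c. c\<^sub>1 \<le> c \<Longrightarrow> \<alpha>\<^sub>1\<^sup>2 * ln c \<le> c"
      unfolding eventually_at_top_linorder by blast
    \<comment> \<open>Halving \<open>\<kappa>\<close> pays for the factor 2 of
      \<open>ln_ratio_le_double\<close>; \<open>C\<close> and \<open>\<delta>\<^sub>0\<close> are
      kept.\<close>
    have "\<kappa> / 2 * ln (1 / \<delta>) * ln (\<alpha>\<^sub>1 * c / ln (1 / \<delta>)) - C \<le> real (D \<delta> c)"
      if c: "max 2 (max c\<^sub>0 c\<^sub>1) \<le> c" and \<delta>: "c powr (- \<alpha>\<^sub>1) \<le> \<delta>" "\<delta> \<le> \<delta>\<^sub>0" for c \<delta>
    proof -
      define L where "L = ln (1 / \<delta>)"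
      have "0 < c powr (- \<alpha>\<^sub>1)" using c by simp
      then have "0 < \<delta>" using \<delta> by linarith
      then have "0 < L"
        unfolding L_def using \<delta> \<delta>0 by (intro ln_gt_zero) (simp add: field_simps)
      have "L \<le> \<alpha>\<^sub>1 * ln c"
        unfolding L_def using c \<delta> by (intro ln_inverse_le) auto
      then have "\<alpha>\<^sub>1 * L \<le> \<alpha>\<^sub>1 * (\<alpha>\<^sub>1 * ln c)"
        using \<alpha>1 by (intro mult_left_mono) auto
      also have "\<dots> \<le> c"
        using c1[of c] c by (simp add: power2_eq_square mult.assoc)
      finally have *: "\<alpha>\<^sub>1 * L \<le> c" .
      \<comment> \<open>In logarithmic form the claim is \<open>L < c * ln \<alpha>\<close>. As
        \<open>\<alpha> \<ge> 4\<close> exceeds e, \<open>ln \<alpha> > 1\<close>, so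
        \<open>L < c\<close> is already enough.\<close>
      have "\<alpha> powr (- c) < \<delta>"
      proof -
        have "1 < ln \<alpha>"
          using \<alpha> exp_le ln_less_cancel_iff[of "exp 1" \<alpha>] by simp
        have "L < 4 * L" using \<open>0 < L\<close> by simp
        also have "\<dots> \<le> \<alpha>\<^sub>1 * L" using \<alpha>1 \<open>0 < L\<close> by (intro mult_right_mono) auto
        also have "\<dots> \<le> c" by fact
        also have "\<dots> < c * ln \<alpha>" using \<open>1 < ln \<alpha>\<close> c by simp
        finally have "- c * ln \<alpha> < ln \<delta>"
          using \<open>0 < \<delta>\<close> by (simp add: L_def ln_div)
        then have "exp (- c * ln \<alpha>) < exp (ln \<delta>)"
          by (simp only: exp_less_cancel_iff)
        then show ?thesis
          using \<alpha> \<open>0 < \<delta>\<close> by (simp add: powr_def)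
      qed
      then have "\<kappa> * L * ln (\<alpha> * c / L) - C \<le> real (D \<delta> c)"
        using bound[rule_format, of c \<delta>] c \<delta> by (simp add: L_def Let_def)
      moreover have "ln (\<alpha>\<^sub>1 * c / L) \<le> 2 * ln (\<alpha> * c / L)"
        using \<alpha> \<alpha>1 c \<open>0 < L\<close> * by (intro ln_ratio_le_double) auto
      then have "\<kappa> / 2 * L * ln (\<alpha>\<^sub>1 * c / L) \<le> \<kappa> / 2 * L * (2 * ln (\<alpha> * c / L))"
        using \<kappa> \<open>0 < L\<close> by (intro mult_left_mono) auto
      ultimately show ?thesis
        by (simp add: L_def)
    qed
    then show ?ii
      unfolding Let_def using \<delta>0 \<kappa>
      by (intro exI[of _ \<delta>\<^sub>0] exI[of _ "\<kappa> / 2"] exI[of _ C] exI[of _ "max 2 (max c\<^sub>0 c\<^sub>1)"]) simp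
  next
    assume ?ii
    then obtain \<delta>\<^sub>0 \<kappa> C c\<^sub>0 :: real where \<delta>0: "0 < \<delta>\<^sub>0" "\<delta>\<^sub>0 < 1/2" and \<kappa>: "0 < \<kappa>"
      and bound: "\<forall>c>0. \<forall>\<delta>. c\<^sub>0 \<le> c \<and> c powr (- \<alpha>\<^sub>1) \<le> \<delta> \<and> \<delta> \<le> \<delta>\<^sub>0 \<longrightarrow>
        (let L = ln (1 / \<delta>) in \<kappa> * L * ln (\<alpha>\<^sub>1 * c / L) - C \<le> real (D \<delta> c))"
      by (elim exE conjE) (rule that)
    \<comment> \<open>Here \<open>\<alpha>\<close> is taken to be \<open>\<alpha>\<^sub>1\<close>
      itself. The coefficient \<open>min \<kappa> k\<close> lies below those of both ranges of
      \<open>\<delta>\<close>. The constant \<open>max C 0\<close> is nonnegative because part (b)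
      gives a bound without additive term, and subtracting a negative \<open>C\<close> would
      strengthen it. The 2 in the threshold for \<open>c\<close> comes from part (b).\<close>
    have "min \<kappa> k * ln (1 / \<delta>) * ln (\<alpha>\<^sub>1 * c / ln (1 / \<delta>)) - max C 0 \<le> real (D \<delta> c)"
      if c: "max 2 c\<^sub>0 \<le> c" and \<delta>: "\<alpha>\<^sub>1 powr (- c) < \<delta>" "\<delta> \<le> \<delta>\<^sub>0" for c \<delta>
    proof -
      define L where "L = ln (1 / \<delta>)"
      define R where "R = ln (\<alpha>\<^sub>1 * c / L)"
      have "0 < \<alpha>\<^sub>1 powr (- c)" using \<alpha>1 by simp
      then have "0 < \<delta>" using \<delta> by linarith
      then have "0 < L"
        unfolding L_def using \<delta> \<delta>0 by (intro ln_gt_zero) (simp add: field_simps)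
      have "0 \<le> R"
        unfolding R_def using \<alpha>1 \<open>0 < L\<close> ln_inverse_less[OF _ \<delta>(1)]
        by (intro ln_ratio_nonneg) (auto simp: L_def)
      with \<open>0 < L\<close> have "0 \<le> L * R" by simp
      show ?thesis
      \<comment> \<open>The endpoint falls to the assumed bound; its negation is exactly the strict
        inequality that part (b) asks for, and \<open>\<delta> \<le> \<delta>\<^sub>0 < 1/2\<close>
        supplies the other upper limit.\<close>
      proof (cases "c powr (- \<alpha>\<^sub>1) \<le> \<delta>")
        case True
        then have "\<kappa> * (L * R) - C \<le> real (D \<delta> c)"
          using bound[rule_format, of c \<delta>] c \<delta> by (simp add: Let_def L_def R_def mult.assoc)
        moreover have "min \<kappa> k * (L * R) \<le> \<kappa> * (L * R)"
          using \<open>0 \<le> L * R\<close> by (intro mult_right_mono) auto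
        ultimately show ?thesis
          by (simp add: L_def R_def mult.assoc)
      next
        case False
        then have "k * (L * R) \<le> real (D \<delta> c)"
          using KDL[rule_format, of c \<delta>] c \<delta> \<delta>0 by (simp add: Let_def L_def R_def)
        moreover have "min \<kappa> k * (L * R) \<le> k * (L * R)"
          using \<open>0 \<le> L * R\<close> by (intro mult_right_mono) auto
        ultimately show ?thesis
          by (simp add: L_def R_def mult.assoc)
      qed
    qed
    then show ?i
      unfolding Let_def using \<alpha>1 \<delta>0 \<kappa> k
      by (intro exI[of _ \<alpha>\<^sub>1] exI[of _ \<delta>\<^sub>0] exI[of _ "min \<kappa> k"] exI[of _ "max C 0"]
          exI[of _ "max 2 c\<^sub>0"]) simp
  qed
qed

end
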